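(* Let $S$ be a Banach inverse semigroup with norm $\|\cdot\|$. Then $S$ equipped with the norm topology is a Hausdorff topological inverse semigroup. In addition, $S$ is conditionally monotone-complete, and the partial order $\leqslant_S$ is compatible with the norm topology. Moreover, if $(x_n)_n$ is a monotone net in $S$, then the following conditions are equivalent: (1) $(x_n)_n$ converges; (2) $(x_n)_n$ has a supinf; (3) $\{x_n\}_n$ is bounded; (4) $\{\|x_n\|\}_n$ is bounded; (5) $\{\|\delta x_n\|\}_n$ is bounded.
   Context: Semigroups are written additively but are not assumed commutative. A semigroup $(S,+)$ is inverse if every $x\in S$ has a unique $x^*\in S$ with $x+x^*+x=x$ and $x^*+x+x^*=x^*$. $E(S)$ denotes the set of idempotents ($e+e=e$), which commute with each other. The natural partial order is: $x\leqslant_S y$ iff $y=x+e$ for some $e\in E(S)$. Write $\delta x:=x+x^*$. A pseudo-norm on an inverse semigroup $S$ is a map $\|\cdot\|:S\to\mathbb{R}_+$ such that for all $x,y,z\in S$: $\|x+y^*\|=\|y+x^*\|$; $\|x+x^*\|\leqslant\|x+y^*\|$; and $\|x+y^*\|+\|z+z^*\|\leqslant\|x+z^*\|+\|z+y^*\|$. For $e\in E(S)$ let $S_e=\{x\in S: x+e=e+x=x\}$. A norm is a pseudo-norm such that, for all $e\in E(S)$ and $x\in S_e$, $\|x\|=\|e\|$ implies $x=e$. A norm is cyclically permutable if $\|x+y\|=\|y+x\|$ for all $x,y\in S$. The intrinsic metric is $d_1(x,y)=\|x+y^*\|-\frac{\|\delta x\|+\|\delta y\|}{2}$, and the norm topology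 is the topology it induces. A Banach inverse semigroup is an inverse semigroup with a cyclically permutable norm that is Cauchy complete with respect to $d_1$. A topological inverse semigroup is an inverse semigroup with a topology for which $(x,y)\mapsto x+y$ and $x\mapsto x^*$ are continuous. A net is monotone if it is non-decreasing or non-increasing with respect to $\leqslant_S$ (on a Banach inverse semigroup this order coincides with the one defined by the partial metric $p(x,y)=\|x+y^*\|$, namely $x\leq_p y$ iff $p(x,x)\leqslant p(y,y)$ and $p(x,z)\leqslant p(y,z)$ for all $z$). The supinf of a monotone net $(x_n)_n$, if it exists, is the supremum of $\{x_n\}_n$ if the net is non-decreasing and the infimum if it is non-increasing. A subset of a poset is bounded if it has both an upper bound and a lower bound. A poset is conditionally monotone-complete if every bounded monotone net has a supinf. A topology and a partial order are compatible if, whenever $x$ is the supinf of a monotone net, the net converges to $x$.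
   Formalization: The five-way equivalence fails for nets with no first index; it is stated as printed when a first index exists, and for all monotone nets with "bounded" in (3)–(5) meaning bounded on some tail, plus (3)⇒(4)⇔(5)⇒(1) literally for every monotone net. *)

theory Defs
  imports "HOL-Analysis.Analysis"
begin

section \<open>Inverse semigroups\<close>

class inverse_semigroup_add = semigroup_add +
  assumes ex1_star: "\<exists>!y. x + y + x = x \<and> y + x + y = y"

definition star :: "'a::inverse_semigroup_add \<Rightarrow> 'a" where
  "star x = (THE y. x + y + x = x \<and> y + x + y = y)"

definition delta :: "'a::inverse_semigroup_add \<Rightarrow> 'a" where
  "delta x = x + star x"

lemma star_ax: "x + star x + x = x" "star x + x + star x = star x"
  using theI'[OF ex1_star[of x]] unfolding star_def by blast+

lemma star_unique: "x + y + x = x \<Longrightarrow> y + x + y = y \<Longrightarrow> star x = y"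
  using ex1_star[of x] star_ax[of x] by blast

lemma star_star [simp]: "star (star x) = x"
  by (rule star_unique) (simp_all add: star_ax)

lemma star_idem: "e + e = e \<Longrightarrow> star e = e"
  by (rule star_unique) simp_all

lemma idem_add:
  fixes e f :: "'a::inverse_semigroup_add"
  assumes e: "e + e = e" and f: "f + f = f"
  shows "(e + f) + (e + f) = e + f"
proof -
  define s where "s = star (e + f)"
  have s: "e + (f + (s + (e + f))) = e + f" "s + (e + (f + s)) = s"
    using star_ax[of "e + f"] unfolding s_def by (simp_all add: add.assoc)
  have ee: "e + (e + z) = e + z" and ff: "f + (f + z) = f + z" for z
    using e f by (metis add.assoc)+
  have s2: "s + (e + (f + (s + z))) = s + z" for z using s(2) by (metis add.assoc)
  have "star (e + f) = f + (s + e)"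
    by (rule star_unique) (simp_all add: add.assoc ee ff s s2)
  then have eq: "s = f + (s + e)" by (simp add: s_def)
  have "s + s = (f + (s + e)) + (f + (s + e))" using eq by simp
  also have "\<dots> = f + (s + e)" by (simp add: add.assoc s2)
  finally have "s + s = s" using eq by simp
  then have "star s = s" by (rule star_idem)
  then have "e + f = s" by (simp add: s_def)
  with \<open>s + s = s\<close> show ?thesis by simp
qed

lemma idem_commute:
  fixes e f :: "'a::inverse_semigroup_add"
  assumes e: "e + e = e" and f: "f + f = f"
  shows "e + f = f + e"
proof -
  have ee: "e + (e + z) = e + z" and ff: "f + (f + z) = f + z" for z
    using e f by (metis add.assoc)+
  have "star (e + f) = f + e"
    using idem_add[OF e f] idem_add[OF f e]
    by (intro star_unique) (simp_all add: add.assoc ee ff)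
  then show ?thesis using star_idem[OF idem_add[OF e f]] by simp
qed

lemma delta_idem: "delta x + delta x = delta x"
  unfolding delta_def using star_ax(1)[of x] by (metis add.assoc)

lemma star_add:
  fixes x y :: "'a::inverse_semigroup_add"
  shows "star (x + y) = star y + star x"
proof (rule star_unique)
  have c: "(y + star y) + (star x + x) = (star x + x) + (y + star y)"
    by (rule idem_commute) (metis add.assoc star_ax)+
  have "x + y + (star y + star x) + (x + y) = x + ((y + star y) + (star x + x)) + y"
    by (simp add: add.assoc)
  also have "\<dots> = (x + star x + x) + (y + star y + y)" unfolding c by (simp add: add.assoc)
  finally show "x + y + (star y + star x) + (x + y) = x + y" by (simp add: star_ax)
  have "star y + star x + (x + y) + (star y + star x) =
      star y + ((star x + x) + (y + star y)) + star x" by (simp add: add.assoc)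
  also have "\<dots> = (star y + y + star y) + (star x + x + star x)"
    unfolding c[symmetric] by (simp add: add.assoc)
  finally show "star y + star x + (x + y) + (star y + star x) = star y + star x"
    by (simp add: star_ax)
qed

definition idempotents :: "'a::inverse_semigroup_add set" where
  "idempotents = {e. e + e = e}"

definition local_part :: "'a::inverse_semigroup_add \<Rightarrow> 'a set" where
  "local_part e = {x. x + e = x \<and> e + x = x}"

text \<open>In this orientation of the natural partial order, adding an idempotent makes an element
  larger; on idempotents it is the join-semilattice order, the opposite of the convention common
  in semigroup theory.\<close>

definition nat_le :: "'a::inverse_semigroup_add \<Rightarrow> 'a \<Rightarrow> bool" where
  "nat_le x y \<longleftrightarrow> (\<exists>e\<in>idempotents. y = x + e)"

definition topological_inverse_semigroup :: "'a::inverse_semigroup_add topology \<Rightarrow> bool" where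
  "topological_inverse_semigroup T \<longleftrightarrow>
     topspace T = UNIV \<and>
     continuous_map (prod_topology T T) T (\<lambda>(x, y). x + y) \<and>
     continuous_map T T star"


section \<open>Norms\<close>

definition pseudo_norm :: "('a::inverse_semigroup_add \<Rightarrow> real) \<Rightarrow> bool" where
  "pseudo_norm N \<longleftrightarrow>
     (\<forall>x. 0 \<le> N x) \<and>
     (\<forall>x y. N (x + star y) = N (y + star x)) \<and>
     (\<forall>x y. N (x + star x) \<le> N (x + star y)) \<and>
     (\<forall>x y z. N (x + star y) + N (z + star z) \<le> N (x + star z) + N (z + star y))"

definition semigroup_norm :: "('a::inverse_semigroup_add \<Rightarrow> real) \<Rightarrow> bool" where
  "semigroup_norm N \<longleftrightarrow>
     pseudo_norm N \<and> (\<forall>e\<in>idempotents. \<forall>x\<in>local_part e. N x = N e \<longrightarrow> x = e)"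

definition cyclically_permutable :: "('a::inverse_semigroup_add \<Rightarrow> real) \<Rightarrow> bool" where
  "cyclically_permutable N \<longleftrightarrow> (\<forall>x y. N (x + y) = N (y + x))"

definition intrinsic_dist ::
    "('a::inverse_semigroup_add \<Rightarrow> real) \<Rightarrow> 'a \<Rightarrow> 'a \<Rightarrow> real" where
  "intrinsic_dist N x y = N (x + star y) - (N (delta x) + N (delta y)) / 2"

text \<open>The intrinsic distance is a metric, so that the metric-space notions below apply to it.\<close>

lemma delta_eqI:
  assumes N: "semigroup_norm N" and eq: "N w = N (delta x)" and w: "delta x + w = w"
  shows "delta w = delta x"
proof -
  have P: "\<And>x y. N (x + star x) \<le> N (x + star y)"
    using N unfolding semigroup_norm_def pseudo_norm_def by blast
  have e: "delta x + delta w = delta w"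
    using w unfolding delta_def by (metis add.assoc)
  have c: "delta w + delta x = delta w"
    using e idem_commute[OF delta_idem delta_idem, of x w] by simp
  have "N (delta x) \<le> N (delta w)"
    using P[of "delta x" "delta w"] e by (simp add: star_idem delta_idem)
  moreover have "N (delta w) \<le> N w"
  proof -
    have "star (star w + w) = star w + w" by (simp add: star_add)
    then show ?thesis
      using P[of w "star w + w"] star_ax(1)[of w] by (simp add: delta_def add.assoc)
  qed
  ultimately have n: "N (delta w) = N (delta x)" using eq by simp
  have "delta x \<in> idempotents" "delta w \<in> local_part (delta x)"
    using e c by (simp_all add: idempotents_def local_part_def delta_idem)
  then show ?thesis using N n unfolding semigroup_norm_def by blast
qed

lemma intrinsic_dist_eq_0:
  assumes N: "semigroup_norm N" and C: "cyclically_permutable N"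
    and d0: "intrinsic_dist N x y = 0"
  shows "x = y"
proof -
  have S: "\<And>x y. N (x + star y) = N (y + star x)"
    and P: "\<And>x y. N (x + star x) \<le> N (x + star y)"
    using N unfolding semigroup_norm_def pseudo_norm_def by blast+
  have cyc: "\<And>x y. N (x + y) = N (y + x)"
    using C unfolding cyclically_permutable_def by blast
  have n: "N (x + star y) = N (delta x)" "N (y + star x) = N (delta y)"
    using d0 P[of x y] P[of y x] S[of x y] by (simp_all add: intrinsic_dist_def delta_def)
  have d1: "delta (x + star y) = delta x"
    using n(1) by (intro delta_eqI[OF N])
      (simp_all add: delta_def add.assoc[symmetric] star_ax)
  have d2: "delta (y + star x) = delta y"
    using n(2) by (intro delta_eqI[OF N])
      (simp_all add: delta_def add.assoc[symmetric] star_ax)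
  have xy: "star x + x = star y + y"
  proof -
    let ?e = "star x + x" and ?f = "star y + y"
    have ie: "?e + ?e = ?e" "?f + ?f = ?f" by (metis add.assoc star_ax)+
    have "star x + ((x + star y) + (y + star x)) + x = star x + (x + star x) + x"
      using d1 by (simp add: delta_def star_add)
    then have "?e + ?f + ?e = ?e" by (simp add: add.assoc[symmetric] star_ax)
    moreover have "star y + ((y + star x) + (x + star y)) + y = star y + (y + star y) + y"
      using d2 by (simp add: delta_def star_add)
    then have "?f + ?e + ?f = ?f" by (simp add: add.assoc[symmetric] star_ax)
    ultimately show ?thesis using idem_commute[OF ie] ie by (metis add.assoc)
  qed
  have key: "star b + a = star a + a"
    if ab: "star a + a = star b + b" and n: "N (a + star b) = N (delta a)" for a b
  proof -
    let ?e = "star a + a"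
    have "?e \<in> idempotents" unfolding idempotents_def by simp (metis add.assoc star_ax)
    moreover have "star b + a \<in> local_part ?e"
      unfolding local_part_def
      by (simp add: add.assoc[symmetric] star_ax) (metis ab add.assoc star_ax)
    moreover have "N (star b + a) = N ?e"
      using n cyc[of "star b" a] cyc[of "star a" a] by (simp add: delta_def)
    ultimately show ?thesis using N unfolding semigroup_norm_def by blast
  qed
  have 1: "star y + x = star x + x" by (rule key[OF xy n(1)])
  have 2: "star x + y = star y + y" by (rule key[OF xy[symmetric] n(2)])
  have 3: "star y = star x"
  proof (rule star_unique[symmetric])
    have "x + (star y + x) = x + (star x + x)" using 1 by simp
    then show "x + star y + x = x" by (simp add: add.assoc[symmetric] star_ax)
    have "star y + x + star y = star y + y + star y" using 1 xy by simp
    then show "star y + x + star y = star y" by (simp add: star_ax)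
  qed
  then have "star (star y) = star (star x)" by simp
  then show ?thesis by simp
qed

lemma Metric_space_intrinsic_dist:
  assumes N: "semigroup_norm N" and C: "cyclically_permutable N"
  shows "Metric_space UNIV (intrinsic_dist N)"
proof
  have S: "\<And>x y. N (x + star y) = N (y + star x)"
    and P: "\<And>x y. N (x + star x) \<le> N (x + star y)"
    and T: "\<And>x y z. N (x + star y) + N (z + star z) \<le> N (x + star z) + N (z + star y)"
    using N unfolding semigroup_norm_def pseudo_norm_def by blast+
  fix x y z
  show "0 \<le> intrinsic_dist N x y"
    using P[of x y] P[of y x] S[of x y] by (simp add: intrinsic_dist_def delta_def)
  show "intrinsic_dist N x y = intrinsic_dist N y x"
    using S[of x y] by (simp add: intrinsic_dist_def)
  show "intrinsic_dist N x y = 0 \<longleftrightarrow> x = y"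
    using intrinsic_dist_eq_0[OF N C] by (auto simp: intrinsic_dist_def delta_def)
  show "intrinsic_dist N x z \<le> intrinsic_dist N x y + intrinsic_dist N y z"
    using T[of x z y] unfolding intrinsic_dist_def delta_def by argo
qed

definition norm_topology :: "('a::inverse_semigroup_add \<Rightarrow> real) \<Rightarrow> 'a topology" where
  "norm_topology N = Metric_space.mtopology UNIV (intrinsic_dist N)"

definition banach_inverse_semigroup :: "('a::inverse_semigroup_add \<Rightarrow> real) \<Rightarrow> bool" where
  "banach_inverse_semigroup N \<longleftrightarrow>
     semigroup_norm N \<and> cyclically_permutable N \<and>
     Metric_space.mcomplete UNIV (intrinsic_dist N)"


section \<open>Order-theoretic notions\<close>

text \<open>The relation \<open>le\<close> plays the role of the order of a poset whose carrier is the whole type.\<close>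

definition is_upper_bound :: "('a \<Rightarrow> 'a \<Rightarrow> bool) \<Rightarrow> 'a set \<Rightarrow> 'a \<Rightarrow> bool" where
  "is_upper_bound le A u \<longleftrightarrow> (\<forall>a\<in>A. le a u)"

definition is_lower_bound :: "('a \<Rightarrow> 'a \<Rightarrow> bool) \<Rightarrow> 'a set \<Rightarrow> 'a \<Rightarrow> bool" where
  "is_lower_bound le A l \<longleftrightarrow> (\<forall>a\<in>A. le l a)"

definition is_supremum :: "('a \<Rightarrow> 'a \<Rightarrow> bool) \<Rightarrow> 'a set \<Rightarrow> 'a \<Rightarrow> bool" where
  "is_supremum le A s \<longleftrightarrow>
     is_upper_bound le A s \<and> (\<forall>u. is_upper_bound le A u \<longrightarrow> le s u)"

definition is_infimum :: "('a \<Rightarrow> 'a \<Rightarrow> bool) \<Rightarrow> 'a set \<Rightarrow> 'a \<Rightarrow> bool" where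
  "is_infimum le A s \<longleftrightarrow>
     is_lower_bound le A s \<and> (\<forall>l. is_lower_bound le A l \<longrightarrow> le l s)"

definition order_bounded :: "('a \<Rightarrow> 'a \<Rightarrow> bool) \<Rightarrow> 'a set \<Rightarrow> bool" where
  "order_bounded le A \<longleftrightarrow> (\<exists>u. is_upper_bound le A u) \<and> (\<exists>l. is_lower_bound le A l)"


section \<open>Nets\<close>

definition directed_set :: "'i set \<Rightarrow> ('i \<Rightarrow> 'i \<Rightarrow> bool) \<Rightarrow> bool" where
  "directed_set D r \<longleftrightarrow>
     D \<noteq> {} \<and>
     (\<forall>i\<in>D. r i i) \<and>
     (\<forall>i\<in>D. \<forall>j\<in>D. \<forall>k\<in>D. r i j \<longrightarrow> r j k \<longrightarrow> r i k) \<and>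
     (\<forall>i\<in>D. \<forall>j\<in>D. \<exists>k\<in>D. r i k \<and> r j k)"

definition tail :: "'i set \<Rightarrow> ('i \<Rightarrow> 'i \<Rightarrow> bool) \<Rightarrow> 'i \<Rightarrow> 'i set" where
  "tail D r n = {i\<in>D. r n i}"

definition net_filter :: "'i set \<Rightarrow> ('i \<Rightarrow> 'i \<Rightarrow> bool) \<Rightarrow> 'i filter" where
  "net_filter D r = (INF n\<in>D. principal (tail D r n))"

lemma eventually_net_filter:
  assumes "directed_set D r"
  shows "eventually P (net_filter D r) \<longleftrightarrow> (\<exists>n\<in>D. \<forall>i\<in>D. r n i \<longrightarrow> P i)"
proof -
  have D: "D \<noteq> {}" "\<And>i j. i \<in> D \<Longrightarrow> j \<in> D \<Longrightarrow> \<exists>k\<in>D. r i k \<and> r j k"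
    "\<And>i j k. i \<in> D \<Longrightarrow> j \<in> D \<Longrightarrow> k \<in> D \<Longrightarrow> r i j \<Longrightarrow> r j k \<Longrightarrow> r i k"
    using assms unfolding directed_set_def by blast+
  have "eventually P (net_filter D r) \<longleftrightarrow>
      (\<exists>n\<in>D. eventually P (principal (tail D r n)))"
    unfolding net_filter_def
  proof (rule eventually_INF_base[OF D(1)])
    fix a b assume ab: "a \<in> D" "b \<in> D"
    obtain k where k: "k \<in> D" "r a k" "r b k" using D(2)[OF ab] by blast
    have "tail D r k \<subseteq> tail D r a \<inter> tail D r b"
      unfolding tail_def using D(3)[OF ab(1) k(1) _ k(2)] D(3)[OF ab(2) k(1) _ k(3)] by blast
    with k(1) show "\<exists>x\<in>D. principal (tail D r x)
        \<le> inf (principal (tail D r a)) (principal (tail D r b))"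
      by (auto simp: inf_principal)
  qed
  then show ?thesis by (auto simp: eventually_principal tail_def)
qed

definition net_converges_to ::
    "'a topology \<Rightarrow> 'i set \<Rightarrow> ('i \<Rightarrow> 'i \<Rightarrow> bool) \<Rightarrow> ('i \<Rightarrow> 'a) \<Rightarrow> 'a \<Rightarrow> bool" where
  "net_converges_to T D r x l \<longleftrightarrow> limitin T x l (net_filter D r)"

definition net_nondecreasing ::
    "('a \<Rightarrow> 'a \<Rightarrow> bool) \<Rightarrow> 'i set \<Rightarrow> ('i \<Rightarrow> 'i \<Rightarrow> bool) \<Rightarrow> ('i \<Rightarrow> 'a) \<Rightarrow> bool" where
  "net_nondecreasing le D r x \<longleftrightarrow> (\<forall>i\<in>D. \<forall>j\<in>D. r i j \<longrightarrow> le (x i) (x j))"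

definition net_nonincreasing ::
    "('a \<Rightarrow> 'a \<Rightarrow> bool) \<Rightarrow> 'i set \<Rightarrow> ('i \<Rightarrow> 'i \<Rightarrow> bool) \<Rightarrow> ('i \<Rightarrow> 'a) \<Rightarrow> bool" where
  "net_nonincreasing le D r x \<longleftrightarrow> (\<forall>i\<in>D. \<forall>j\<in>D. r i j \<longrightarrow> le (x j) (x i))"

definition monotone_net ::
    "('a \<Rightarrow> 'a \<Rightarrow> bool) \<Rightarrow> 'i set \<Rightarrow> ('i \<Rightarrow> 'i \<Rightarrow> bool) \<Rightarrow> ('i \<Rightarrow> 'a) \<Rightarrow> bool" where
  "monotone_net le D r x \<longleftrightarrow>
     directed_set D r \<and> (net_nondecreasing le D r x \<or> net_nonincreasing le D r x)"

text \<open>For a partial order, a net that is both non-decreasing and non-increasing is constant, so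
  the two alternatives below never conflict.\<close>

definition is_supinf ::
    "('a \<Rightarrow> 'a \<Rightarrow> bool) \<Rightarrow> 'i set \<Rightarrow> ('i \<Rightarrow> 'i \<Rightarrow> bool) \<Rightarrow> ('i \<Rightarrow> 'a) \<Rightarrow> 'a \<Rightarrow> bool" where
  "is_supinf le D r x s \<longleftrightarrow>
     (net_nondecreasing le D r x \<and> is_supremum le (x ` D) s) \<or>
     (net_nonincreasing le D r x \<and> is_infimum le (x ` D) s)"

text \<open>The type argument of the next two notions is the type from which index sets of nets are
  taken, since a definition cannot quantify over types.  A theorem that leaves \<open>'i\<close> free covers
  nets over all directed sets.\<close>

definition conditionally_monotone_complete ::
    "'i itself \<Rightarrow> ('a \<Rightarrow> 'a \<Rightarrow> bool) \<Rightarrow> bool" where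
  "conditionally_monotone_complete _ le \<longleftrightarrow>
     (\<forall>(D::'i set) r x. monotone_net le D r x \<and> order_bounded le (x ` D) \<longrightarrow>
        (\<exists>s. is_supinf le D r x s))"

definition order_compatible ::
    "'i itself \<Rightarrow> 'a topology \<Rightarrow> ('a \<Rightarrow> 'a \<Rightarrow> bool) \<Rightarrow> bool" where
  "order_compatible _ T le \<longleftrightarrow>
     (\<forall>(D::'i set) r x s. monotone_net le D r x \<and> is_supinf le D r x s \<longrightarrow>
        net_converges_to T D r x s)"

end

theory Submission
  imports Defs
begin

text \<open>Cyclic permutability turns the third pseudo-norm axiom into a submodularity inequality, which
  makes addition nonexpansive in each argument.  For comparable \<open>x \<le> y\<close> the intrinsic distance is
  half of \<open>\<parallel>\<delta> y\<parallel> - \<parallel>\<delta> x\<parallel>\<close>, so a monotone net is Cauchy as soon as the monotone real net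
  \<open>\<parallel>\<delta> x\<^sub>n\<parallel>\<close> is bounded.  The order is closed, because \<open>x \<le> y\<close> is the equation
  \<open>y = x + y\<^sup>* + y\<close>; hence the limit of a monotone net is its supinf.\<close>

section \<open>Algebra of the natural order\<close>

lemma star_add_idem: "(star x + x) + (star x + x) = star x + x"
  by (metis add.assoc star_ax(1))

text \<open>The existential witness can always be the canonical idempotent
  \<open>star y + y\<close>. This turns the order into an equation between continuous operations,
  which is what makes it closed.\<close>

lemma nat_le_iff: "nat_le x y \<longleftrightarrow> y = x + (star y + y)"
proof
  assume "nat_le x y"
  then obtain e where e: "e + e = e" "y = x + e"
    by (auto simp: nat_le_def idempotents_def)
  \<comment> \<open>For \<open>y = x + e\<close> the idempotent \<open>star y + y\<close> expands to
    \<open>e + (star x + x) + e\<close>; commuting idempotents lets \<open>x\<close> absorb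
    \<open>star x + x\<close>.\<close>
  have "x + (star y + y) = x + ((e + (star x + x)) + e)"
    using e by (simp add: star_add star_idem add.assoc)
  also have "\<dots> = x + ((star x + x) + (e + e))"
    using idem_commute[OF e(1) star_add_idem[of x]] by (simp add: add.assoc)
  also have "\<dots> = y"
    using e star_ax(1)[of x] by (simp add: add.assoc[symmetric])
  finally show "y = x + (star y + y)" ..
next
  assume "y = x + (star y + y)"
  then show "nat_le x y"
    unfolding nat_le_def idempotents_def using star_add_idem[of y] by blast
qed

lemma nat_le_refl: "nat_le x x"
  unfolding nat_le_iff using star_ax(1)[of x] by (simp add: add.assoc)

text \<open>With \<open>y = x + e\<close> and \<open>x = y + f\<close>, the element \<open>y\<close>
  absorbs \<open>e\<close>, so commuting \<open>e\<close> and \<open>f\<close> collapses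
  \<open>x + e\<close> to \<open>y + f\<close>.\<close>

lemma nat_le_antisym:
  assumes "nat_le x y" "nat_le y x"
  shows "x = y"
proof -
  obtain e f where e: "e + e = e" "y = x + e" and f: "f + f = f" "x = y + f"
    using assms by (auto simp: nat_le_def idempotents_def)
  have "x + e = y + (e + f)"
    using idem_commute[OF e(1) f(1)] by (subst f(2)) (simp add: add.assoc)
  also have "\<dots> = (y + e) + f" by (simp add: add.assoc)
  also have "y + e = y" by (subst (1 2) e(2)) (simp add: add.assoc e(1))
  finally show ?thesis unfolding e(2)[symmetric] f(2)[symmetric] by (rule sym)
qed

section \<open>Directed sets and monotone nets\<close>

lemma directed_set_upper:
  assumes "directed_set D r" "i \<in> D" "j \<in> D"
  obtains k where "k \<in> D" "r i k" "r j k"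
  using assms unfolding directed_set_def by blast

lemma directed_set_nonempty: "directed_set D r \<Longrightarrow> D \<noteq> {}"
  unfolding directed_set_def by blast

lemma directed_set_refl: "directed_set D r \<Longrightarrow> i \<in> D \<Longrightarrow> r i i"
  unfolding directed_set_def by blast

lemma directed_set_trans:
  "directed_set D r \<Longrightarrow> i \<in> D \<Longrightarrow> j \<in> D \<Longrightarrow> k \<in> D \<Longrightarrow> r i j \<Longrightarrow> r j k \<Longrightarrow> r i k"
  unfolding directed_set_def by blast

section \<open>Tails of directed sets\<close>

lemma mem_tail_iff: "i \<in> tail D r n \<longleftrightarrow> i \<in> D \<and> r n i"
  by (auto simp: tail_def)

lemma tail_self: "directed_set D r \<Longrightarrow> n \<in> D \<Longrightarrow> n \<in> tail D r n"
  by (simp add: mem_tail_iff directed_set_refl)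

lemma directed_set_tail:
  assumes "directed_set D r" "n \<in> D"
  shows "directed_set (tail D r n) r"
proof -
  note D = directed_set_refl[OF assms(1)] directed_set_trans[OF assms(1)]
  have "\<exists>k\<in>tail D r n. r i k \<and> r j k" if "i \<in> tail D r n" "j \<in> tail D r n" for i j
  proof -
    have ij: "i \<in> D" "r n i" "j \<in> D" using that by (simp_all only: mem_tail_iff)
    obtain k where k: "k \<in> D" "r i k" "r j k"
      using directed_set_upper[OF assms(1) ij(1,3)] .
    have "k \<in> tail D r n"
      using D(2)[OF assms(2) ij(1) k(1) ij(2) k(2)] k(1) by (simp only: mem_tail_iff)
    with k show ?thesis by blast
  qed
  moreover have "tail D r n \<noteq> {}" using tail_self[OF assms] by blast
  moreover have "r i i" if "i \<in> tail D r n" for i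
    using D(1)[of i] that by (simp only: mem_tail_iff)
  moreover have "r i k"
    if "i \<in> tail D r n" "j \<in> tail D r n" "k \<in> tail D r n" "r i j" "r j k" for i j k
    using D(2)[of i j k] that by (simp only: mem_tail_iff)
  ultimately show ?thesis unfolding directed_set_def by (intro conjI ballI impI)
qed

section \<open>Monotone nets\<close>

lemma net_nondecreasingD:
  "net_nondecreasing le D r x \<Longrightarrow> i \<in> D \<Longrightarrow> j \<in> D \<Longrightarrow> r i j \<Longrightarrow> le (x i) (x j)"
  unfolding net_nondecreasing_def by simp

lemma net_nonincreasingD:
  "net_nonincreasing le D r x \<Longrightarrow> i \<in> D \<Longrightarrow> j \<in> D \<Longrightarrow> r i j \<Longrightarrow> le (x j) (x i)"
  unfolding net_nonincreasing_def by simp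

lemma monotone_net_directed_set: "monotone_net le D r x \<Longrightarrow> directed_set D r"
  by (simp only: monotone_net_def)

lemma monotone_net_cases:
  assumes "monotone_net le D r x"
  obtains "net_nondecreasing le D r x" | "net_nonincreasing le D r x"
  using assms unfolding monotone_net_def by iprover

lemma monotone_net_tail:
  assumes "monotone_net le D r x" "n \<in> D"
  shows "monotone_net le (tail D r n) r x"
proof -
  have "net_nondecreasing le (tail D r n) r x" if "net_nondecreasing le D r x"
    unfolding net_nondecreasing_def mem_tail_iff Ball_def using net_nondecreasingD[OF that] by simp
  moreover have "net_nonincreasing le (tail D r n) r x" if "net_nonincreasing le D r x"
    unfolding net_nonincreasing_def mem_tail_iff Ball_def using net_nonincreasingD[OF that] by simp
  moreover have "directed_set (tail D r n) r"
    by (rule directed_set_tail[OF monotone_net_directed_set[OF assms(1)] assms(2)])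
  ultimately show ?thesis
    using assms(1) unfolding monotone_net_def by iprover
qed

section \<open>Net filters and Cauchy nets\<close>

lemma net_filter_neq_bot:
  assumes "directed_set D r"
  shows "net_filter D r \<noteq> bot"
proof
  assume "net_filter D r = bot"
  then have "\<exists>n\<in>D. \<forall>i\<in>D. r n i \<longrightarrow> False"
    unfolding eventually_net_filter[OF assms, symmetric] by simp
  then obtain n where n: "n \<in> D" "\<And>i. i \<in> D \<Longrightarrow> \<not> r n i"
    by blast
  moreover have "r n n" using directed_set_refl[OF assms n(1)] .
  ultimately show False by blast
qed

lemma eventually_net_filter_tail:
  assumes "directed_set D r" "n \<in> D"
  shows "eventually (\<lambda>i. i \<in> tail D r n) (net_filter D r)"
  unfolding eventually_net_filter[OF assms(1)] mem_tail_iff using assms(2) by blast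

text \<open>Completeness speaks of sequences only. Indices \<open>s k\<close> with error
  \<open>1 / (k + 1)\<close> yield a Cauchy sequence, whose limit attracts the whole net because all
  terms after \<open>s k\<close> are close to \<open>x (s k)\<close>.\<close>

lemma (in Metric_space) mcomplete_Cauchy_net:
  assumes comp: "mcomplete" and D: "directed_set D r" and x: "\<And>i. i \<in> D \<Longrightarrow> x i \<in> M"
    and C: "\<And>\<epsilon>. 0 < \<epsilon> \<Longrightarrow> \<exists>n\<in>D. \<forall>i\<in>D. r n i \<longrightarrow> d (x n) (x i) < \<epsilon>"
  shows "\<exists>l. net_converges_to mtopology D r x l"
proof -
  have "\<forall>k. \<exists>n\<in>D. \<forall>i\<in>D. r n i \<longrightarrow> d (x n) (x i) < inverse (real (Suc k))"
    using C by simp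
  then obtain s where s: "\<And>k. s k \<in> D"
    and sd: "\<And>k i. i \<in> D \<Longrightarrow> r (s k) i \<Longrightarrow> d (x (s k)) (x i) < inverse (real (Suc k))"
    by metis
  \<comment> \<open>The indices \<open>s k\<close> are chosen independently and need not increase
    along \<open>r\<close>, so two of them are compared through a common later index
    \<open>m\<close>.\<close>
  have small: "d (x (s k)) (x (s l)) < \<epsilon>"
    if "inverse (real (Suc K)) < \<epsilon> / 2" "K \<le> k" "K \<le> l" for k l K \<epsilon>
  proof -
    obtain m where m: "m \<in> D" "r (s k) m" "r (s l) m"
      using directed_set_upper[OF D s s] by blast
    have "d (x (s k)) (x (s l)) \<le> d (x (s k)) (x m) + d (x (s l)) (x m)"
      using triangle[OF x[OF s] x[OF m(1)] x[OF s]] commute by metis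
    also have "\<dots> < inverse (real (Suc k)) + inverse (real (Suc l))"
      using sd m by (intro add_strict_mono)
    also have "\<dots> \<le> inverse (real (Suc K)) + inverse (real (Suc K))"
      using that by (intro add_mono le_imp_inverse_le) auto
    finally show ?thesis using that by simp
  qed
  have "MCauchy (x \<circ> s)"
    unfolding MCauchy_def
  proof (intro conjI allI impI)
    show "range (x \<circ> s) \<subseteq> M" using x s by auto
    fix \<epsilon> :: real assume "0 < \<epsilon>"
    then obtain K where "inverse (real (Suc K)) < \<epsilon> / 2"
      using reals_Archimedean[of "\<epsilon> / 2"] by auto
    from small[OF this] show "\<exists>K. \<forall>k l. K \<le> k \<longrightarrow> K \<le> l \<longrightarrow> d ((x \<circ> s) k) ((x \<circ> s) l) < \<epsilon>"
      unfolding o_def by blast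
  qed
  then obtain l where "limitin mtopology (x \<circ> s) l sequentially"
    using comp unfolding mcomplete_def by blast
  then have l: "l \<in> M"
    and lim: "\<And>\<epsilon>. 0 < \<epsilon> \<Longrightarrow> \<exists>K. \<forall>k\<ge>K. d (x (s k)) l < \<epsilon>"
    unfolding limit_metric_sequentially o_def by meson+
  have "limitin mtopology x l (net_filter D r)"
    unfolding limitin_metric
  proof (intro conjI allI impI)
    show "l \<in> M" by (rule l)
    fix \<epsilon> :: real assume "0 < \<epsilon>"
    then obtain J where J: "inverse (real (Suc J)) < \<epsilon> / 2"
      using reals_Archimedean[of "\<epsilon> / 2"] by auto
    obtain K where K: "\<And>k. K \<le> k \<Longrightarrow> d (x (s k)) l < \<epsilon> / 2"
      using lim[of "\<epsilon> / 2"] \<open>0 < \<epsilon>\<close> by auto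
    \<comment> \<open>\<open>J\<close> controls the distance from \<open>x (s k)\<close> to later
      terms of the net, \<open>K\<close> the distance from \<open>x (s k)\<close> to
      \<open>l\<close>; each contributes \<open>\<epsilon> / 2\<close>.\<close>
    define k where "k = max J K"
    have "inverse (real (Suc k)) \<le> inverse (real (Suc J))"
      by (intro le_imp_inverse_le) (auto simp: k_def)
    then have inv_k: "inverse (real (Suc k)) < \<epsilon> / 2" using J by linarith
    have "x i \<in> M \<and> d (x i) l < \<epsilon>" if i: "i \<in> D" "r (s k) i" for i
    proof -
      have "d (x i) l \<le> d (x (s k)) (x i) + d (x (s k)) l"
        using triangle[OF x[OF i(1)] x[OF s] l] commute by metis
      then show ?thesis using sd[OF i] inv_k K[of k] x[OF i(1)] by (simp add: k_def)
    qed
    then show "\<forall>\<^sub>F i in net_filter D r. x i \<in> M \<and> d (x i) l < \<epsilon>"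
      unfolding eventually_net_filter[OF D] using s by blast
  qed
  then show ?thesis unfolding net_converges_to_def by blast
qed

text \<open>The supinf bounds the net on one side; on the tail at \<open>n\<close>, the term
  \<open>x n\<close> bounds it on the other. Over all of \<open>D\<close> this second bound may be
  missing when there is no least index.\<close>

lemma order_bounded_tail_if_supinf:
  assumes D: "directed_set D r" and s: "is_supinf nat_le D r x s" and n: "n \<in> D"
  shows "order_bounded nat_le (x ` tail D r n)"
proof -
  have sub: "tail D r n \<subseteq> D" by (auto simp only: mem_tail_iff)
  from s consider "net_nondecreasing nat_le D r x" "is_supremum nat_le (x ` D) s"
    | "net_nonincreasing nat_le D r x" "is_infimum nat_le (x ` D) s"
    unfolding is_supinf_def by blast
  then show ?thesis
  proof cases
    case 1
    have "is_upper_bound nat_le (x ` tail D r n) s"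
      using 1(2) sub unfolding is_supremum_def is_upper_bound_def by blast
    moreover have "is_lower_bound nat_le (x ` tail D r n) (x n)"
      using net_nondecreasingD[OF 1(1) n] by (auto simp only: is_lower_bound_def mem_tail_iff)
    ultimately show ?thesis unfolding order_bounded_def by blast
  next
    case 2
    have "is_lower_bound nat_le (x ` tail D r n) s"
      using 2(2) sub unfolding is_infimum_def is_lower_bound_def by blast
    moreover have "is_upper_bound nat_le (x ` tail D r n) (x n)"
      using net_nonincreasingD[OF 2(1) n] by (auto simp only: is_upper_bound_def mem_tail_iff)
    ultimately show ?thesis unfolding order_bounded_def by blast
  qed
qed

text \<open>\<open>is_supinf\<close> is a disjunction, so antisymmetry alone settles only nets
  monotone in a single direction. A net monotone in both is constant, and a singleton has the same
  supremum and infimum.\<close>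

lemma supinf_unique:
  fixes x :: "'i \<Rightarrow> 'a::inverse_semigroup_add"
  assumes s: "is_supinf nat_le D r x s" and t: "is_supinf nat_le D r x t"
    and D: "directed_set D r"
  shows "s = t"
proof -
  obtain n where n: "n \<in> D" using directed_set_nonempty[OF D] by blast
  have singleton: "x ` D = {x n}"
    if mono: "net_nondecreasing nat_le D r x" "net_nonincreasing nat_le D r x"
  proof -
    have eq: "x i = x j" if "i \<in> D" "j \<in> D" "r i j" for i j
      using nat_le_antisym net_nondecreasingD[OF mono(1) that] net_nonincreasingD[OF mono(2) that]
      by blast
    have "x i = x n" if i: "i \<in> D" for i
    proof -
      obtain k where k: "k \<in> D" "r i k" "r n k" using directed_set_upper[OF D i n] .
      then show ?thesis using eq[OF i k(1,2)] eq[OF n k(1,3)] by simp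
    qed
    then show ?thesis using n by blast
  qed
  have sup_eq: "u = v" if "is_supremum nat_le A u" "is_supremum nat_le A v"
    for A and u v :: 'a
    using that nat_le_antisym unfolding is_supremum_def by blast
  have inf_eq: "u = v" if "is_infimum nat_le A u" "is_infimum nat_le A v"
    for A and u v :: 'a
    using that nat_le_antisym unfolding is_infimum_def by blast
  have sup1: "is_supremum nat_le {a} a" and inf1: "is_infimum nat_le {a} a" for a :: 'a
    using nat_le_refl[of a]
    by (simp_all add: is_supremum_def is_upper_bound_def is_infimum_def is_lower_bound_def)
  show ?thesis
  proof (cases "net_nondecreasing nat_le D r x \<and> net_nonincreasing nat_le D r x")
    case True
    have "u = x n" if "is_supinf nat_le D r x u" for u
      using that sup_eq[OF _ sup1] inf_eq[OF _ inf1] True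
      unfolding is_supinf_def singleton[OF conjunct1[OF True] conjunct2[OF True]] by blast
    from this[OF s] this[OF t] show ?thesis by simp
  next
    case False
    then show ?thesis using s t sup_eq inf_eq unfolding is_supinf_def by blast
  qed
qed

section \<open>Cyclically permutable norms\<close>

locale cyclic_norm =
  fixes N :: "'a::inverse_semigroup_add \<Rightarrow> real"
  assumes norm: "semigroup_norm N" and cyclic: "cyclically_permutable N"
begin

sublocale Metric_space UNIV "intrinsic_dist N"
  by (rule Metric_space_intrinsic_dist[OF norm cyclic])

section \<open>Norm axioms and first estimates\<close>

lemma norm_nonneg: "0 \<le> N x"
  using norm by (auto simp: semigroup_norm_def pseudo_norm_def)

lemma norm_sym: "N (x + star y) = N (y + star x)"
  using norm unfolding semigroup_norm_def pseudo_norm_def by blast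

lemma norm_delta_le: "N (delta x) \<le> N (x + star y)"
  using norm unfolding semigroup_norm_def pseudo_norm_def delta_def by blast

lemma norm_triangle: "N (x + star y) + N (delta z) \<le> N (x + star z) + N (z + star y)"
  using norm unfolding semigroup_norm_def pseudo_norm_def delta_def by blast

lemma norm_cyclic: "N (x + y) = N (y + x)"
  using cyclic unfolding cyclically_permutable_def by blast

text \<open>\<open>x\<close> absorbs the star-invariant element \<open>star x + x\<close>, so the
  second axiom with this element in place of \<open>y\<close> gives the bound.\<close>

lemma norm_delta_le_norm: "N (delta x) \<le> N x"
  using norm_delta_le[of x "star x + x"] star_ax(1)[of x]
  by (simp add: star_add add.assoc)

lemma norm_star_add: "N (star x + x) = N (delta x)"
  using norm_cyclic unfolding delta_def by simp

text \<open>This is the triangle axiom for \<open>e\<close> and \<open>star z\<close> with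
  intermediate element \<open>f\<close>. If \<open>f + z = z\<close>, it says that adding
  \<open>e\<close> on the left raises the norm of \<open>z\<close> by at most as much as that of
  \<open>f\<close>.\<close>

lemma norm_submodular:
  assumes e: "e + e = e" and f: "f + f = f"
  shows "N (e + z) + N f \<le> N (e + f) + N (f + z)"
  using norm_triangle[of e "star z" f] by (simp add: star_idem f delta_def)

text \<open>Cyclicity moves \<open>star x\<close> to the right of \<open>y\<close>, and symmetry
  restores \<open>x + star y\<close>. Estimates for addition on one side thereby transfer to the
  other.\<close>

lemma dist_star: "intrinsic_dist N (star x) (star y) = intrinsic_dist N x y"
  using norm_cyclic[of "star x" y] norm_sym[of x y]
  by (simp add: intrinsic_dist_def delta_def norm_cyclic[of "star x" x] norm_cyclic[of "star y" y])

text \<open>Translation by \<open>z\<close> enters the distance only through the idempotent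
  \<open>z + star z\<close>, as in \<open>x + ?e + star y\<close>. The estimate \<open>sub\<close>
  is used for \<open>(x, y)\<close> and \<open>(y, x)\<close>; the mean of both is the
  claim.\<close>

lemma dist_add_right_le: "intrinsic_dist N (x + z) (y + z) \<le> intrinsic_dist N x y"
proof -
  let ?e = "z + star z"
  have e: "?e + ?e = ?e" using delta_idem[of z] by (simp add: delta_def)
  \<comment> \<open>Cyclic rotation brings \<open>?e\<close> to the front; then submodularity
    applies with \<open>f = star x + x\<close> and \<open>z = star y + x\<close>.\<close>
  have sub: "N (x + ?e + star y) + N (delta x) \<le> N (x + star y) + N (x + ?e + star x)" for x y
  proof -
    have "N (x + ?e + star y) = N (?e + (star y + x))"
      using norm_cyclic[of x "?e + star y"] by (simp add: add.assoc)
    moreover have "N ((star x + x) + (star y + x)) = N (x + star y)"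
      using norm_cyclic[of "star x + x" "star y + x"] norm_cyclic[of "star y" x] star_ax(1)[of x]
      by (simp add: add.assoc)
    moreover have "N (x + ?e + star x) = N (?e + (star x + x))"
      using norm_cyclic[of x "?e + star x"] by (simp add: add.assoc)
    ultimately show ?thesis
      using norm_submodular[OF e star_add_idem[of x], of "star y + x"] norm_star_add[of x]
      by linarith
  qed
  have "N (y + ?e + star x) = N (x + ?e + star y)"
    using norm_sym[of "y + ?e" x] by (simp add: star_add add.assoc)
  then show ?thesis
    using sub[of x y] sub[of y x] norm_sym[of x y]
    by (simp only: intrinsic_dist_def delta_def star_add add.assoc) argo
qed

lemma dist_add_left_le: "intrinsic_dist N (z + x) (z + y) \<le> intrinsic_dist N x y"
  using dist_add_right_le[of "star x" "star z" "star y"] dist_star[of "z + x" "z + y"]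
    dist_star[of x y] by (simp add: star_add)

lemma dist_add_le:
  "intrinsic_dist N (x + y) (x' + y') \<le> intrinsic_dist N x x' + intrinsic_dist N y y'"
  using triangle[of "x + y" "x' + y" "x' + y'"] dist_add_right_le[of x y x']
    dist_add_left_le[of x' y y'] by simp

section \<open>The norm topology and closedness of the order\<close>

lemma limitin_norm_topology_iff:
  "limitin (norm_topology N) f l F \<longleftrightarrow>
    (\<forall>\<epsilon>>0. \<forall>\<^sub>F i in F. intrinsic_dist N (f i) l < \<epsilon>)"
  by (simp add: norm_topology_def limitin_metric)

lemma limitin_add:
  assumes f: "limitin (norm_topology N) f a F" and g: "limitin (norm_topology N) g b F"
  shows "limitin (norm_topology N) (\<lambda>i. f i + g i) (a + b) F"
  unfolding limitin_norm_topology_iff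
proof (intro allI impI)
  fix \<epsilon> :: real assume "0 < \<epsilon>"
  then have "\<forall>\<^sub>F i in F. intrinsic_dist N (f i) a < \<epsilon> / 2"
    "\<forall>\<^sub>F i in F. intrinsic_dist N (g i) b < \<epsilon> / 2"
    using f g half_gt_zero unfolding limitin_norm_topology_iff by blast+
  then show "\<forall>\<^sub>F i in F. intrinsic_dist N (f i + g i) (a + b) < \<epsilon>"
  proof eventually_elim
    case (elim i)
    then show ?case using dist_add_le[of "f i" "g i" a b] by linarith
  qed
qed

lemma limitin_star:
  "limitin (norm_topology N) f a F \<Longrightarrow> limitin (norm_topology N) (\<lambda>i. star (f i)) (star a) F"
  by (simp add: limitin_norm_topology_iff dist_star)

lemma topspace_norm_topology [simp]: "topspace (norm_topology N) = UNIV"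
  by (simp add: norm_topology_def)

lemma Hausdorff_space_norm_topology: "Hausdorff_space (norm_topology N)"
  unfolding norm_topology_def by (rule Hausdorff_space_mtopology)

lemma topological_inverse_semigroup_norm_topology:
  "topological_inverse_semigroup (norm_topology N)"
  unfolding topological_inverse_semigroup_def
proof (intro conjI)
  show "continuous_map (prod_topology (norm_topology N) (norm_topology N)) (norm_topology N)
      (\<lambda>(x, y). x + y)"
    unfolding continuous_map_atin
  proof (intro ballI)
    fix p :: "'a \<times> 'a"
    \<comment> \<open>Along the filter at \<open>p\<close> the identity converges to
      \<open>p\<close>, hence so do both coordinates, and \<open>limitin_add\<close> combines
      them.\<close>
    have "limitin (prod_topology (norm_topology N) (norm_topology N)) id p
        (atin (prod_topology (norm_topology N) (norm_topology N)) p)"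
      using continuous_map_id unfolding continuous_map_atin by (fastforce simp: id_def)
    then show "limitin (norm_topology N) (\<lambda>(x, y). x + y) ((\<lambda>(x, y). x + y) p)
        (atin (prod_topology (norm_topology N) (norm_topology N)) p)"
      using limitin_add by (auto simp: limitin_pairwise case_prod_unfold o_def)
  qed
  show "continuous_map (norm_topology N) (norm_topology N) star"
    unfolding continuous_map_atin
  proof (intro ballI)
    fix a :: 'a
    have "limitin (norm_topology N) (\<lambda>x. x) a (atin (norm_topology N) a)"
      using continuous_map_id unfolding continuous_map_atin by (fastforce simp: id_def)
    then show "limitin (norm_topology N) star (star a) (atin (norm_topology N) a)"
      by (rule limitin_star)
  qed
qed simp

text \<open>The equation of \<open>nat_le_iff\<close> holds eventually and both its sides converge,
  so uniqueness of limits in a Hausdorff space carries it over to \<open>a\<close> and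
  \<open>b\<close>.\<close>

lemma nat_le_limitin:
  assumes f: "limitin (norm_topology N) f a F" and g: "limitin (norm_topology N) g b F"
    and le: "\<forall>\<^sub>F i in F. nat_le (f i) (g i)" and F: "F \<noteq> bot"
  shows "nat_le a b"
proof -
  have "limitin (norm_topology N) (\<lambda>i. f i + (star (g i) + g i)) (a + (star b + b)) F"
    by (intro limitin_add limitin_star f g)
  moreover have "\<forall>\<^sub>F i in F. f i + (star (g i) + g i) = g i"
    using le by (rule eventually_mono) (simp add: nat_le_iff)
  ultimately have "limitin (norm_topology N) g (a + (star b + b)) F"
    by (rule limitin_transform_eventually[rotated])
  then show ?thesis
    using limitin_Hausdorff_unique[OF g _ F Hausdorff_space_norm_topology]
    unfolding nat_le_iff by blast
qed

text \<open>With \<open>y = x + e\<close>, both inequalities are instances of the triangle axiom for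
  \<open>x\<close> and idempotents built from \<open>star x + x\<close> and \<open>e\<close>. The
  distance formula holds because \<open>x + star y\<close> equals \<open>delta y\<close>.\<close>

lemma
  assumes "nat_le x y"
  shows norm_mono: "N x \<le> N y"
    and norm_diff_le: "N y \<le> N x + (N (delta y) - N (delta x))"
    and dist_eq: "intrinsic_dist N x y = (N (delta y) - N (delta x)) / 2"
proof -
  obtain e where e: "e + e = e" and y: "y = x + e"
    using assms by (auto simp: nat_le_def idempotents_def)
  let ?f = "star x + x"
  have f: "?f + ?f = ?f" by (rule star_add_idem)
  have xf: "x + (star x + (x + z)) = x + z" for z
    by (metis add.assoc star_ax(1))
  have ef: "e + ?f = ?f + e" by (rule idem_commute[OF e f])
  have sf: "star ?f = ?f" by (rule star_idem[OF f])
  have i: "(?f + e) + (?f + e) = ?f + e" by (rule idem_add[OF f e])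
  have dy: "delta y = x + e + star x"
    using e by (simp add: delta_def y star_add star_idem) (metis add.assoc)
  have ndy: "N (delta y) = N (?f + e)"
    using norm_cyclic[of "x + e" "star x"] by (simp add: dy add.assoc)
  \<comment> \<open>With intermediate element \<open>?f + e\<close> the norm
    \<open>N (?f + e)\<close> occurs on both sides and cancels, leaving
    \<open>N x \<le> N y\<close>.\<close>
  have "N (x + star ?f) + N (delta (?f + e)) \<le> N (x + star (?f + e)) + N ((?f + e) + star ?f)"
    by (rule norm_triangle)
  moreover have "x + star ?f = x" "x + star (?f + e) = y"
    unfolding sf star_idem[OF i] y using xf[of e] star_ax(1)[of x] by (simp_all add: add.assoc)
  moreover have "delta (?f + e) = ?f + e" by (simp add: delta_def star_idem[OF i] i)
  moreover have "(?f + e) + star ?f = ?f + e" using ef f by (metis add.assoc sf)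
  ultimately show "N x \<le> N y" by simp
  \<comment> \<open>With intermediate element \<open>?f\<close> the axiom reads
    \<open>N y + N (delta x) \<le> N x + N (delta y)\<close>.\<close>
  have "N (x + star e) + N (delta ?f) \<le> N (x + star ?f) + N (?f + star e)"
    by (rule norm_triangle)
  moreover have "delta ?f = ?f" by (simp only: delta_def sf f)
  ultimately show "N y \<le> N x + (N (delta y) - N (delta x))"
    using \<open>x + star ?f = x\<close> ndy norm_star_add[of x] y star_idem[OF e] by simp
  have xy: "x + star y = delta y"
    using dy by (simp add: y star_add star_idem[OF e] add.assoc)
  then show "intrinsic_dist N x y = (N (delta y) - N (delta x)) / 2"
    by (simp add: intrinsic_dist_def field_simps)
qed

section \<open>Bounded norms and limits of monotone nets\<close>

lemma bounded_norm_iff: "bounded ((\<lambda>i. N (f i)) ` J) \<longleftrightarrow> (\<exists>B. \<forall>i\<in>J. N (f i) \<le> B)"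
  using norm_nonneg by (auto simp: bounded_iff)

lemma bounded_norm_if_order_bounded:
  assumes "order_bounded nat_le (x ` J)"
  shows "bounded ((\<lambda>i. N (x i)) ` J)"
  using assms norm_mono unfolding bounded_norm_iff order_bounded_def is_upper_bound_def by blast

text \<open>One direction is \<open>norm_delta_le_norm\<close>. For the other,
  \<open>norm_diff_le\<close> bounds the growth of \<open>N\<close> between comparable terms by the
  growth of the \<open>delta\<close> norms, so one fixed term \<open>x n\<close> controls all
  norms.\<close>

lemma bounded_norm_iff_bounded_norm_delta:
  assumes "monotone_net nat_le D r x"
  shows "bounded ((\<lambda>i. N (x i)) ` D) \<longleftrightarrow> bounded ((\<lambda>i. N (delta (x i))) ` D)"
proof
  assume "bounded ((\<lambda>i. N (x i)) ` D)"
  then show "bounded ((\<lambda>i. N (delta (x i))) ` D)"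
    unfolding bounded_norm_iff using norm_delta_le_norm order_trans by meson
next
  assume "bounded ((\<lambda>i. N (delta (x i))) ` D)"
  then obtain B where B: "\<And>i. i \<in> D \<Longrightarrow> N (delta (x i)) \<le> B"
    by (auto simp: bounded_norm_iff)
  have D: "directed_set D r" using assms by (rule monotone_net_directed_set)
  then obtain n where n: "n \<in> D" using directed_set_nonempty by blast
  \<comment> \<open>\<open>x m\<close> and \<open>x n\<close> need not be comparable, but each is
    comparable with \<open>x k\<close> for an index \<open>k\<close> after both.\<close>
  have "N (x m) \<le> N (x n) + B" if m: "m \<in> D" for m
  proof -
    obtain k where k: "k \<in> D" "r m k" "r n k" using directed_set_upper[OF D m n] .
    consider "nat_le (x m) (x k)" "nat_le (x n) (x k)" | "nat_le (x k) (x m)" "nat_le (x k) (x n)"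
      using assms
    proof (cases rule: monotone_net_cases)
      case 1
      then show ?thesis using k m n that(1) by (auto intro: net_nondecreasingD)
    next
      case 2
      then show ?thesis using k m n that(2) by (auto intro: net_nonincreasingD)
    qed
    then show ?thesis
    proof cases
      case 1
      show ?thesis
        using norm_mono[OF 1(1)] norm_diff_le[OF 1(2)] B[OF k(1)] norm_nonneg[of "delta (x n)"]
        by linarith
    next
      case 2
      show ?thesis
        using norm_mono[OF 2(2)] norm_diff_le[OF 2(1)] B[OF m] norm_nonneg[of "delta (x k)"]
        by linarith
    qed
  qed
  then show "bounded ((\<lambda>i. N (x i)) ` D)" unfolding bounded_norm_iff by blast
qed

text \<open>The order is closed, so comparing a fixed term or a fixed bound with the terms of a tail
  passes to the limit; the fixed element serves as a constant net.\<close>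

lemma is_supinf_if_converges:
  assumes x: "monotone_net nat_le D r x" and l: "net_converges_to (norm_topology N) D r x l"
  shows "is_supinf nat_le D r x l"
proof -
  have D: "directed_set D r" using x by (rule monotone_net_directed_set)
  note F = net_filter_neq_bot[OF D]
  have l: "limitin (norm_topology N) x l (net_filter D r)"
    using l by (simp add: net_converges_to_def)
  have const: "limitin (norm_topology N) (\<lambda>_. a) a (net_filter D r)" for a
    by simp
  have tail: "\<forall>\<^sub>F i in net_filter D r. P i" if "n \<in> D" "\<And>i. i \<in> tail D r n \<Longrightarrow> P i" for n P
    using eventually_net_filter_tail[OF D that(1)] that(2) by (rule eventually_mono)
  obtain n where n: "n \<in> D" using directed_set_nonempty[OF D] by blast
  from x show ?thesis
  proof (cases rule: monotone_net_cases)
    case 1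
    have "nat_le (x i) l" if "i \<in> D" for i
      using 1 that
      by (intro nat_le_limitin[OF const l _ F] tail[OF that])
        (simp add: net_nondecreasingD mem_tail_iff)
    moreover have "nat_le l u" if "is_upper_bound nat_le (x ` D) u" for u
      using that by (intro nat_le_limitin[OF l const _ F] tail[OF n])
        (auto simp: is_upper_bound_def mem_tail_iff)
    ultimately show ?thesis
      using 1 by (auto simp: is_supinf_def is_supremum_def is_upper_bound_def)
  next
    case 2
    have "nat_le l (x i)" if "i \<in> D" for i
      using 2 that
      by (intro nat_le_limitin[OF l const _ F] tail[OF that])
        (simp add: net_nonincreasingD mem_tail_iff)
    moreover have "nat_le u l" if "is_lower_bound nat_le (x ` D) u" for u
      using that by (intro nat_le_limitin[OF const l _ F] tail[OF n])
        (auto simp: is_lower_bound_def mem_tail_iff)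
    ultimately show ?thesis
      using 2 by (auto simp: is_supinf_def is_infimum_def is_lower_bound_def)
  qed
qed

end

section \<open>Banach inverse semigroups\<close>

locale banach_norm = cyclic_norm +
  assumes complete: mcomplete
begin

text \<open>The real net \<open>N (delta (x i))\<close> is monotone and bounded, and by
  \<open>dist_eq\<close> distances between comparable terms of \<open>x\<close> are half its
  increments, so \<open>x\<close> is Cauchy.\<close>

lemma converges_if_bounded_norm_delta:
  assumes x: "monotone_net nat_le D r x" and bd: "bounded ((\<lambda>i. N (delta (x i))) ` D)"
  shows "\<exists>l. net_converges_to (norm_topology N) D r x l"
  unfolding norm_topology_def
proof (rule mcomplete_Cauchy_net[OF complete])
  show D: "directed_set D r" using x by (rule monotone_net_directed_set)
  let ?A = "(\<lambda>i. N (delta (x i))) ` D"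
  have ne: "?A \<noteq> {}" using directed_set_nonempty[OF D] by simp
  have ab: "bdd_above ?A" and bb: "bdd_below ?A"
    using bounded_imp_bdd_above[OF bd] bounded_imp_bdd_below[OF bd] .
  fix \<epsilon> :: real assume \<epsilon>: "0 < \<epsilon>"
  from x show "\<exists>n\<in>D. \<forall>i\<in>D. r n i \<longrightarrow> intrinsic_dist N (x n) (x i) < \<epsilon>"
  proof (cases rule: monotone_net_cases)
    case 1
    \<comment> \<open>A value within \<open>\<epsilon>\<close> of the supremum suffices: all later
      values lie between it and the supremum, so the distances stay below
      \<open>\<epsilon> / 2\<close>.\<close>
    obtain n where n: "n \<in> D" "Sup ?A - \<epsilon> < N (delta (x n))"
      using less_cSup_iff[OF ne ab, of "Sup ?A - \<epsilon>"] \<epsilon> by auto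
    have "intrinsic_dist N (x n) (x i) < \<epsilon>" if i: "i \<in> D" "r n i" for i
    proof -
      have "nat_le (x n) (x i)" using 1 i n by (simp add: net_nondecreasingD)
      moreover have "N (delta (x i)) \<le> Sup ?A" using i ab by (auto intro: cSup_upper)
      ultimately show ?thesis using n \<epsilon> dist_eq by fastforce
    qed
    then show ?thesis using n by blast
  next
    case 2
    obtain n where n: "n \<in> D" "N (delta (x n)) < Inf ?A + \<epsilon>"
      using cInf_less_iff[OF ne bb, of "Inf ?A + \<epsilon>"] \<epsilon> by auto
    have "intrinsic_dist N (x n) (x i) < \<epsilon>" if i: "i \<in> D" "r n i" for i
    proof -
      have "nat_le (x i) (x n)" using 2 i n by (simp add: net_nonincreasingD)
      moreover have "Inf ?A \<le> N (delta (x i))" using i bb by (auto intro: cInf_lower)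
      ultimately show ?thesis using n \<epsilon> dist_eq commute[of "x n" "x i"] by fastforce
    qed
    then show ?thesis using n by blast
  qed
qed simp

text \<open>Convergence depends only on eventual behaviour, and by transitivity a tail of
  \<open>tail D r n\<close> is a tail of \<open>D\<close>.\<close>

lemma converges_if_bounded_norm_delta_tail:
  assumes x: "monotone_net nat_le D r x" and n: "n \<in> D"
    and bd: "bounded ((\<lambda>i. N (delta (x i))) ` tail D r n)"
  shows "\<exists>l. net_converges_to (norm_topology N) D r x l"
proof -
  have D: "directed_set D r" using x by (rule monotone_net_directed_set)
  have mono: "eventually P (net_filter D r)" if "eventually P (net_filter (tail D r n) r)" for P
  proof -
    from that obtain m where m: "m \<in> tail D r n" "\<And>i. i \<in> tail D r n \<Longrightarrow> r m i \<Longrightarrow> P i"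
      unfolding eventually_net_filter[OF directed_set_tail[OF D n]] by blast
    have "P i" if "i \<in> D" "r m i" for i
      using m(2)[of i] m(1) that directed_set_trans[OF D n, of m i] by (simp only: mem_tail_iff)
    then show "eventually P (net_filter D r)"
      unfolding eventually_net_filter[OF D] using m(1) unfolding mem_tail_iff by blast
  qed
  obtain l where "net_converges_to (norm_topology N) (tail D r n) r x l"
    using converges_if_bounded_norm_delta[OF monotone_net_tail[OF x n] bd] by blast
  then have "net_converges_to (norm_topology N) D r x l"
    using mono unfolding net_converges_to_def limitin_norm_topology_iff by simp
  then show ?thesis ..
qed

text \<open>A supinf \<open>s\<close> makes a tail bounded, which forces convergence to some
  \<open>l\<close>. This \<open>l\<close> is a supinf too, so uniqueness identifies it with
  \<open>s\<close>.\<close>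

lemma converges_iff_supinf:
  assumes x: "monotone_net nat_le D r x"
  shows "net_converges_to (norm_topology N) D r x s \<longleftrightarrow> is_supinf nat_le D r x s"
proof
  assume s: "is_supinf nat_le D r x s"
  have D: "directed_set D r" using x by (rule monotone_net_directed_set)
  then obtain n where n: "n \<in> D" using directed_set_nonempty by blast
  have "bounded ((\<lambda>i. N (x i)) ` tail D r n)"
    by (rule bounded_norm_if_order_bounded[OF order_bounded_tail_if_supinf[OF D s n]])
  then have "bounded ((\<lambda>i. N (delta (x i))) ` tail D r n)"
    by (simp only: bounded_norm_iff_bounded_norm_delta[OF monotone_net_tail[OF x n]])
  from converges_if_bounded_norm_delta_tail[OF x n this]
  obtain l where l: "net_converges_to (norm_topology N) D r x l" ..
  then show "net_converges_to (norm_topology N) D r x s"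
    using supinf_unique[OF is_supinf_if_converges[OF x l] s D] by simp
qed (rule is_supinf_if_converges[OF x])

end

text \<open>Boundedness on all of \<open>D\<close> matches convergence when \<open>D\<close> has a
  least index; in general it is asked of some tail. For the nonnegative reals under maximum with
  \<open>N x = x\<close>, the identity net indexed by the reversed order decreases to 0 although its
  values are unbounded.\<close>

theorem theorem6p27:
  fixes N :: "'a::inverse_semigroup_add \<Rightarrow> real"
  assumes "banach_inverse_semigroup N"
  shows
    "Hausdorff_space (norm_topology N) \<and> topological_inverse_semigroup (norm_topology N) \<and>
     conditionally_monotone_complete TYPE('i) (nat_le :: 'a \<Rightarrow> 'a \<Rightarrow> bool) \<and>
     order_compatible TYPE('i) (norm_topology N) nat_le \<and>
     (\<forall>(D::'i set) r (x::'i \<Rightarrow> 'a). monotone_net nat_le D r x \<longrightarrow>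
       (let converges = (\<exists>l. net_converges_to (norm_topology N) D r x l);
            has_supinf = (\<exists>s. is_supinf nat_le D r x s);
            bdd = (\<lambda>J. order_bounded nat_le (x ` J));
            norm_bdd = (\<lambda>J. bounded ((\<lambda>i. N (x i)) ` J));
            delta_bdd = (\<lambda>J. bounded ((\<lambda>i. N (delta (x i))) ` J))
        in
          ((\<exists>n\<in>D. \<forall>i\<in>D. r n i) \<longrightarrow>
             (converges \<longleftrightarrow> has_supinf) \<and>
             (has_supinf \<longleftrightarrow> bdd D) \<and>
             (bdd D \<longleftrightarrow> norm_bdd D) \<and>
             (norm_bdd D \<longleftrightarrow> delta_bdd D)) \<and>
          ((converges \<longleftrightarrow> has_supinf) \<and>
           (has_supinf \<longleftrightarrow> (\<exists>n\<in>D. bdd (tail D r n))) \<and>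
           ((\<exists>n\<in>D. bdd (tail D r n)) \<longleftrightarrow> (\<exists>n\<in>D. norm_bdd (tail D r n))) \<and>
           ((\<exists>n\<in>D. norm_bdd (tail D r n)) \<longleftrightarrow> (\<exists>n\<in>D. delta_bdd (tail D r n)))) \<and>
          ((bdd D \<longrightarrow> norm_bdd D) \<and>
           (norm_bdd D \<longleftrightarrow> delta_bdd D) \<and>
           (delta_bdd D \<longrightarrow> converges))))"
proof -
  interpret banach_norm N
    using assms unfolding banach_inverse_semigroup_def
    by (auto simp: banach_norm_def cyclic_norm_def banach_norm_axioms_def)
  show ?thesis
  proof (intro conjI allI impI, goal_cases)
    case 1
    show ?case by (rule Hausdorff_space_norm_topology)
  next
    case 2
    show ?case by (rule topological_inverse_semigroup_norm_topology)
  next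
    case 3
    have "\<exists>s. is_supinf nat_le D r x s"
      if x: "monotone_net nat_le D r x" and bd: "order_bounded nat_le (x ` D)"
      for D :: "'i set" and r and x :: "'i \<Rightarrow> 'a"
    proof -
      have "bounded ((\<lambda>i. N (delta (x i))) ` D)"
        using bounded_norm_if_order_bounded[OF bd]
        by (simp only: bounded_norm_iff_bounded_norm_delta[OF x])
      from converges_if_bounded_norm_delta[OF x this] show ?thesis
        by (simp only: converges_iff_supinf[OF x])
    qed
    then show ?case by (simp only: conditionally_monotone_complete_def) blast
  next
    case 4
    show ?case
      unfolding order_compatible_def by (simp add: converges_iff_supinf)
  next
    case x: (5 D r x)
    define converges where "converges = (\<exists>l. net_converges_to (norm_topology N) D r x l)"
    define bdd where "bdd = (\<lambda>J. order_bounded nat_le (x ` J))"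
    define norm_bdd where "norm_bdd = (\<lambda>J. bounded ((\<lambda>i. N (x i)) ` J))"
    define delta_bdd where "delta_bdd = (\<lambda>J. bounded ((\<lambda>i. N (delta (x i))) ` J))"
    have D: "directed_set D r" using x by (rule monotone_net_directed_set)
    then obtain n0 where n0: "n0 \<in> D" using directed_set_nonempty by blast
    have supinf: "(\<exists>s. is_supinf nat_le D r x s) = converges"
      unfolding converges_def converges_iff_supinf[OF x] ..
    have bdd_tail: "bdd (tail D r n)" if "converges" "n \<in> D" for n
      using that order_bounded_tail_if_supinf[OF D] converges_iff_supinf[OF x]
      unfolding converges_def bdd_def by blast
    have norm_bdd: "norm_bdd J" if "bdd J" for J
      using that bounded_norm_if_order_bounded unfolding norm_bdd_def bdd_def by blast
    have delta_D: "norm_bdd D = delta_bdd D"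
      unfolding norm_bdd_def delta_bdd_def by (rule bounded_norm_iff_bounded_norm_delta[OF x])
    have delta_tail: "norm_bdd (tail D r n) = delta_bdd (tail D r n)" if "n \<in> D" for n
      unfolding norm_bdd_def delta_bdd_def
      by (rule bounded_norm_iff_bounded_norm_delta[OF monotone_net_tail[OF x that]])
    have conv_D: "converges" if "delta_bdd D"
      using converges_if_bounded_norm_delta[OF x] that unfolding delta_bdd_def converges_def .
    have conv_tail: "converges" if "n \<in> D" "delta_bdd (tail D r n)" for n
      using converges_if_bounded_norm_delta_tail[OF x] that
      unfolding delta_bdd_def converges_def by blast
    \<comment> \<open>Convergence bounds every tail in the order, hence in \<open>N\<close> and in
      the \<open>delta\<close> norms, and a tail with bounded \<open>delta\<close> norms gives back
      convergence. This circle makes every tail condition equal to \<open>converges\<close>.\<close>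
    have tails: "(\<exists>n\<in>D. bdd (tail D r n)) = converges"
      "(\<exists>n\<in>D. norm_bdd (tail D r n)) = converges"
      "(\<exists>n\<in>D. delta_bdd (tail D r n)) = converges"
      using bdd_tail norm_bdd delta_tail conv_tail n0 by blast+
    have least: "bdd D = converges" "norm_bdd D = converges" "delta_bdd D = converges"
      if n: "n \<in> D" "\<forall>i\<in>D. r n i" for n
    proof -
      \<comment> \<open>At a least index the tail is the whole of \<open>D\<close>, so bounds on
        tails become bounds on \<open>D\<close>.\<close>
      have "tail D r n = D" using n(2) by (auto simp: tail_def)
      then have "bdd D" if converges using bdd_tail[OF that n(1)] by simp
      then show "bdd D = converges" "norm_bdd D = converges" "delta_bdd D = converges"
        using norm_bdd delta_D conv_D by blast+
    qed
    show ?case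
      unfolding Let_def converges_def[symmetric] bdd_def[symmetric] norm_bdd_def[symmetric]
        delta_bdd_def[symmetric] supinf tails
      using norm_bdd delta_D conv_D least by blast
  qed
qed

end
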